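(* Consider the parameterized system $\frac{d}{dt}\mathbf{x}=\mathbf{f}(\mathbf{x},\boldsymbol{\alpha})$, $\mathbf{x}(0)=\mathbf{x}_0$, with state variables $\mathbf{x}\in I_{\mathbf{x}}\subseteq\mathbb{R}^d$, parameters $\boldsymbol{\alpha}\in I_{\boldsymbol{\alpha}}\subseteq\mathbb{R}^\ell$ with probability density $\rho_{\boldsymbol{\alpha}}$ on $I_{\boldsymbol{\alpha}}$, and $\mathbf{f}:\mathbb{R}^d\times\mathbb{R}^\ell\to\mathbb{R}^d$. Let $\widetilde{I}_{\boldsymbol{\alpha}}\subseteq\mathbb{R}^\ell$ be an estimated parameter range, in which the system is assumed to be well-posed, with probability density $\widetilde{\rho}_{\boldsymbol{\alpha}}$ on $\widetilde{I}_{\boldsymbol{\alpha}}$. Let $I_\Delta\subset[0,\infty)$ be a compact interval (the range of time lags) with right endpoint $\Delta>0$, let $n\ge1$, $\delta_0,\dots,\delta_{n-1}\in I_\Delta$ and $t=\sum_{i=0}^{n-1}\delta_i$. Suppose $\mathbf{f}(\mathbf{x},\boldsymbol{\alpha})$ is Lipschitz continuous with respect to $\mathbf{x}$ with a uniform Lipschitz constant $L>0$ for all $\boldsymbol{\alpha}\in I_{\boldsymbol{\alpha}}$. Let $\boldsymbol{\Psi}$ be the effective increment of the system (defined in the context), and suppose that the trained neural network $\widehat{\mathbf{N}}:\mathbb{R}^{d+\ell+1}\to\mathbb{R}^d$ satisfies, for a given $\mathcal{E}>0$, $$\left|\widehat{\mathbf{N}}(\mathbf{z},\boldsymbol{\alpha},\delta)-\boldsymbol{\Psi}(\mathbf{z},\boldsymbol{\alpha},\delta)\right|\le\mathcal{E}\qquad\text{for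 all }(\mathbf{z},\boldsymbol{\alpha},\delta)\in I_{\mathbf{x}}\times I_{\boldsymbol{\alpha}}\times I_\Delta .$$ For the given initial condition $\mathbf{x}_0\in I_{\mathbf{x}}$, let $\mathbf{x}(t;\boldsymbol{\alpha})$ and $\widehat{\mathbf{x}}(t;\boldsymbol{\alpha})$ be the exact solution and the network prediction at time $t$ (defined in the context). Put $I_{\boldsymbol{\alpha}}^o=I_{\boldsymbol{\alpha}}\cap\widetilde{I}_{\boldsymbol{\alpha}}$, $I_{\boldsymbol{\alpha}}^-=I_{\boldsymbol{\alpha}}\setminus I_{\boldsymbol{\alpha}}^o$, $\widetilde{I}_{\boldsymbol{\alpha}}^-=\widetilde{I}_{\boldsymbol{\alpha}}\setminus I_{\boldsymbol{\alpha}}^o$, and assume that for some small positive numbers $\gamma$ and $\eta$, $$\int_{I_{\boldsymbol{\alpha}}^o}\left|\rho_{\boldsymbol{\alpha}}(\mathbf{y})-\widetilde{\rho}_{\boldsymbol{\alpha}}(\mathbf{y})\right|d\mathbf{y}\le\gamma,\qquad \int_{\widetilde{I}_{\boldsymbol{\alpha}}^-}\widetilde{\rho}_{\boldsymbol{\alpha}}(\mathbf{y})\,d\mathbf{y}+\int_{I_{\boldsymbol{\alpha}}^-}\rho_{\boldsymbol{\alpha}}(\mathbf{y})\,d\mathbf{y}\le\eta .$$ In addition, assume that $\|\mathbf{x}(t;\cdot)\|_{L^\infty(\widetilde{I}_{\boldsymbol{\alpha}}\cup I_{\boldsymbol{\alpha}})}\le\widetilde{C}_t$. Then $$\left|\mathbb{E}_{\boldsymbol{\alpha}}[\mathbf{x}(t;\boldsymbol{\alpha})]-\widetilde{\mathbb{E}}_{\boldsymbol{\alpha}}[\widehat{\mathbf{x}}(t;\boldsymbol{\alpha})]\right|\le\widetilde{C}_t(\eta+\gamma)+C(1+\eta)\mathcal{E},$$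 $$\left|\mathrm{Var}_{\boldsymbol{\alpha}}[\mathbf{x}(t;\boldsymbol{\alpha})]-\widetilde{\mathrm{Var}}_{\boldsymbol{\alpha}}[\widehat{\mathbf{x}}(t;\boldsymbol{\alpha})]\right|\le(3\widetilde{C}_t^2+C\widetilde{C}_t\mathcal{E})(\eta+\gamma)+(4\widetilde{C}_t+2C\mathcal{E})(1+\eta)C\mathcal{E},$$ where $C=\frac{e^{nL\Delta}-1}{e^{L\Delta}-1}$.
   Context: $|\cdot|$ is the Euclidean norm on $\mathbb{R}^d$, and $\|\mathbf{g}\|_{L^\infty}$ is the $L^\infty$ norm of $|\mathbf{g}|$. Exact solution: $\mathbf{x}(\cdot;\boldsymbol{\alpha},\mathbf{x}_0)$ is the solution of $\frac{d}{dt}\mathbf{x}=\mathbf{f}(\mathbf{x},\boldsymbol{\alpha})$, $\mathbf{x}(0)=\mathbf{x}_0$; the dependence on $\mathbf{x}_0$ is suppressed by writing $\mathbf{x}(t;\boldsymbol{\alpha})$. Flow map: $\boldsymbol{\Phi}_s(\mathbf{z},\boldsymbol{\alpha})=\mathbf{x}(s;\boldsymbol{\alpha},\mathbf{z})$. Effective increment: $\boldsymbol{\Psi}(\mathbf{z},\boldsymbol{\alpha},\delta)=\int_0^\delta\mathbf{f}(\boldsymbol{\Phi}_s(\mathbf{z},\boldsymbol{\alpha}),\boldsymbol{\alpha})\,ds$, so that $\boldsymbol{\Phi}_\delta(\mathbf{z},\boldsymbol{\alpha})=\mathbf{z}+\boldsymbol{\Psi}(\mathbf{z},\boldsymbol{\alpha},\delta)$.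 Neural network: $\widehat{\mathbf{N}}$ is the operator of a feedforward network, i.e. an alternating composition of affine maps and activation functions applied componentwise, with its parameters fixed after training. Network prediction: put $t_0=0$, $t_{k+1}=t_k+\delta_k$, $\widehat{\mathbf{x}}(t_0;\boldsymbol{\alpha})=\mathbf{x}_0$ and $\widehat{\mathbf{x}}(t_{k+1};\boldsymbol{\alpha})=\widehat{\mathbf{x}}(t_k;\boldsymbol{\alpha})+\widehat{\mathbf{N}}(\widehat{\mathbf{x}}(t_k;\boldsymbol{\alpha}),\boldsymbol{\alpha},\delta_k)$ for $k=0,\dots,n-1$. Then $t=t_n$, and $\widehat{\mathbf{x}}(t;\boldsymbol{\alpha})$ means $\widehat{\mathbf{x}}(t_n;\boldsymbol{\alpha})$. Statistics: for an $\mathbb{R}^d$-valued function $\mathbf{g}$ of the parameter (measurability being understood), $\mathbb{E}_{\boldsymbol{\alpha}}[\mathbf{g}]=\int_{I_{\boldsymbol{\alpha}}}\mathbf{g}(\mathbf{y})\rho_{\boldsymbol{\alpha}}(\mathbf{y})\,d\mathbf{y}$, $\mathrm{Var}_{\boldsymbol{\alpha}}[\mathbf{g}]=\int_{I_{\boldsymbol{\alpha}}}(\mathbf{g}(\mathbf{y})-\mathbb{E}_{\boldsymbol{\alpha}}[\mathbf{g}])^2\rho_{\boldsymbol{\alpha}}(\mathbf{y})\,d\mathbf{y}$, $\widetilde{\mathbb{E}}_{\boldsymbol{\alpha}}[\mathbf{g}]=\int_{\widetilde{I}_{\boldsymbol{\alpha}}}\mathbf{g}(\mathbf{y})\widetilde{\rho}_{\boldsymbol{\alpha}}(\mathbf{y})\,d\mathbf{y}$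 and $\widetilde{\mathrm{Var}}_{\boldsymbol{\alpha}}[\mathbf{g}]=\int_{\widetilde{I}_{\boldsymbol{\alpha}}}(\mathbf{g}(\mathbf{y})-\widetilde{\mathbb{E}}_{\boldsymbol{\alpha}}[\mathbf{g}])^2\widetilde{\rho}_{\boldsymbol{\alpha}}(\mathbf{y})\,d\mathbf{y}$; squares of vectors are taken componentwise.
   Formalization: The claim fails as worded; three hypotheses are strengthened: the network accuracy bound and the Lipschitz constant L are also assumed for parameters in the estimated range, and the network predictions before the final step are assumed to stay in I_x for those parameters. *)

theory Defs
  imports "HOL-Analysis.Analysis" "HOL-Probability.Essential_Supremum"
begin

section \<open>The parameterized system\<close>

definition solves_ivp ::
  "(real^'d \<Rightarrow> real^'l \<Rightarrow> real^'d) \<Rightarrow> real^'l \<Rightarrow> real^'d \<Rightarrow> (real \<Rightarrow> real^'d) \<Rightarrow> bool" where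
  "solves_ivp f \<alpha> z x \<longleftrightarrow>
     x 0 = z \<and> (\<forall>t\<ge>0. (x has_vector_derivative f (x t) \<alpha>) (at t within {0..}))"

text \<open>A solution, seen as a total function on the reals, is determined only for nonnegative
  times. The description therefore selects the common value at time \<open>t\<close> of all solutions,
  not the solution itself.\<close>

definition exact_solution ::
  "(real^'d \<Rightarrow> real^'l \<Rightarrow> real^'d) \<Rightarrow> real^'l \<Rightarrow> real^'d \<Rightarrow> real \<Rightarrow> real^'d" where
  "exact_solution f \<alpha> z t = (THE u. \<exists>x. solves_ivp f \<alpha> z x \<and> x t = u)"

definition flow_map ::
  "(real^'d \<Rightarrow> real^'l \<Rightarrow> real^'d) \<Rightarrow> real \<Rightarrow> real^'d \<Rightarrow> real^'l \<Rightarrow> real^'d" where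
  "flow_map f s z \<alpha> = exact_solution f \<alpha> z s"

definition effective_increment ::
  "(real^'d \<Rightarrow> real^'l \<Rightarrow> real^'d) \<Rightarrow> real^'d \<Rightarrow> real^'l \<Rightarrow> real \<Rightarrow> real^'d" where
  "effective_increment f z \<alpha> \<delta> = integral {0..\<delta>} (\<lambda>s. f (flow_map f s z \<alpha>) \<alpha>)"

section \<open>Feedforward networks\<close>

text \<open>The widths of the hidden layers vary, so the values of a hidden layer of width \<open>m\<close> are
  kept in a function on the naturals, of which only the entries below \<open>m\<close> are ever read.
  \<open>hidden_layer m h\<close> says that \<open>h\<close> maps the network input to such values by alternating affine
  maps and componentwise activations; the activation may differ from layer to layer.\<close>

inductive hidden_layer :: "nat \<Rightarrow> (real^'i \<Rightarrow> nat \<Rightarrow> real) \<Rightarrow> bool" where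
  first_layer: "0 < m \<Longrightarrow> hidden_layer m (\<lambda>u j. \<sigma> ((\<Sum>i\<in>UNIV. W j i * u $ i) + b j))"
| next_layer: "hidden_layer m h \<Longrightarrow> 0 < m' \<Longrightarrow>
    hidden_layer m' (\<lambda>u j. \<sigma> ((\<Sum>i<m. W j i * h u i) + b j))"

text \<open>The output map is affine. This covers networks that end with an activation: take the
  identity as the output map.\<close>

definition feedforward_network :: "(real^'i \<Rightarrow> real^'o) \<Rightarrow> bool" where
  "feedforward_network N \<longleftrightarrow>
     (\<exists>W b. N = (\<lambda>u. W *v u + b)) \<or>
     (\<exists>m h W b. hidden_layer m h \<and> N = (\<lambda>u. \<chi> k. (\<Sum>i<m. W k i * h u i) + b k))"

text \<open>The index type \<open>'d + 'l + unit\<close> has \<open>d + l + 1\<close> elements.\<close>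

definition network_input :: "real^'d \<Rightarrow> real^'l \<Rightarrow> real \<Rightarrow> real^('d + 'l + unit)" where
  "network_input z \<alpha> \<delta> =
     (\<chi> i. case i of Inl j \<Rightarrow> z $ j | Inr (Inl k) \<Rightarrow> \<alpha> $ k | Inr (Inr _) \<Rightarrow> \<delta>)"

primrec network_prediction ::
  "(real^('d + 'l + unit) \<Rightarrow> real^'d) \<Rightarrow> (nat \<Rightarrow> real) \<Rightarrow> real^'d \<Rightarrow> nat \<Rightarrow> real^'l \<Rightarrow> real^'d" where
  "network_prediction N \<delta> x0 0 \<alpha> = x0"
| "network_prediction N \<delta> x0 (Suc k) \<alpha> =
     network_prediction N \<delta> x0 k \<alpha>
       + N (network_input (network_prediction N \<delta> x0 k \<alpha>) \<alpha> (\<delta> k))"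

section \<open>Statistics over a parameter range\<close>

definition prob_density_on :: "(real^'l) set \<Rightarrow> (real^'l \<Rightarrow> real) \<Rightarrow> bool" where
  "prob_density_on I \<rho> \<longleftrightarrow>
     I \<in> sets lebesgue \<and> (\<forall>y\<in>I. 0 \<le> \<rho> y) \<and> has_bochner_integral (lebesgue_on I) \<rho> 1"

definition param_mean ::
  "(real^'l) set \<Rightarrow> (real^'l \<Rightarrow> real) \<Rightarrow> (real^'l \<Rightarrow> real^'d) \<Rightarrow> real^'d" where
  "param_mean I \<rho> g = (\<integral>y. \<rho> y *\<^sub>R g y \<partial>lebesgue_on I)"

definition square_componentwise :: "real^'d \<Rightarrow> real^'d" where
  "square_componentwise v = (\<chi> i. (v $ i)\<^sup>2)"

definition param_variance ::
  "(real^'l) set \<Rightarrow> (real^'l \<Rightarrow> real) \<Rightarrow> (real^'l \<Rightarrow> real^'d) \<Rightarrow> real^'d" where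
  "param_variance I \<rho> g =
     (\<integral>y. \<rho> y *\<^sub>R square_componentwise (g y - param_mean I \<rho> g) \<partial>lebesgue_on I)"

definition Linf_norm :: "(real^'l) set \<Rightarrow> (real^'l \<Rightarrow> real^'d) \<Rightarrow> ereal" where
  "Linf_norm I g = esssup (lebesgue_on I) (\<lambda>y. ereal (norm (g y)))"

end

theory Submission imports Defs begin

text \<open>
  The error \<open>e\<^sub>k\<close> of the network prediction after \<open>k\<close> steps satisfies
  \<open>e\<^sub>k\<^sub>+\<^sub>1 \<le> exp (L * \<Delta>) * e\<^sub>k + E\<close>, because the exact flow is a semigroup expanding distances over a
  time lag \<open>\<delta> \<le> \<Delta>\<close> by at most \<open>exp (L * \<Delta>)\<close>; summing the geometric series gives an error of
  at most \<open>C * E\<close>, uniformly in the parameter. The statistics are compared by first changing the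
  density for the fixed function \<open>x(t)\<close>, which costs \<open>\<eta> + \<gamma>\<close> times its bound once both
  densities are extended by zero, and then changing the function for the fixed estimated density.
  For the variance this is applied to the two terms of \<open>Var g = E(g\<^sup>2) - (E g)\<^sup>2\<close>, with
  \<open>a\<^sup>2 - b\<^sup>2\<close> controlled by \<open>\<bar>a - b\<bar> * \<bar>a + b\<bar>\<close>.
\<close>

section \<open>Lipschitz initial value problems\<close>

text \<open>Gronwall's estimate: the squared distance weighted by \<open>exp (- 2 * L * s)\<close>
  cannot grow, because Cauchy-Schwarz and the Lipschitz bound make its derivative nonpositive.
  Squaring avoids the points where the solutions meet and the norm is not differentiable. Equal
  initial values give uniqueness.\<close>

lemma lipschitz_flow_distance:
  fixes x y :: "real \<Rightarrow> 'a::real_inner"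
  assumes F: "L-lipschitz_on UNIV F"
    and x: "\<And>t. t \<ge> 0 \<Longrightarrow> (x has_vector_derivative F (x t)) (at t within {0..})"
    and y: "\<And>t. t \<ge> 0 \<Longrightarrow> (y has_vector_derivative F (y t)) (at t within {0..})"
    and t: "0 \<le> t"
  shows "norm (x t - y t) \<le> exp (L * t) * norm (x 0 - y 0)"
proof -
  define g where "g s = exp (- 2 * L * s) * ((x s - y s) \<bullet> (x s - y s))" for s
  define g' where "g' s = 2 * exp (- 2 * L * s)
      * ((x s - y s) \<bullet> (F (x s) - F (y s)) - L * ((x s - y s) \<bullet> (x s - y s)))" for s
  have deriv: "(g has_field_derivative g' s) (at s within {0..})" if "0 \<le> s" for s
  proof -
    let ?d = "\<lambda>s. x s - y s"
    have "(?d has_vector_derivative F (x s) - F (y s)) (at s within {0..})"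
      by (intro has_vector_derivative_diff x y that)
    then have "((\<lambda>s. ?d s \<bullet> ?d s) has_vector_derivative
        ?d s \<bullet> (F (x s) - F (y s)) + (F (x s) - F (y s)) \<bullet> ?d s) (at s within {0..})"
      by (intro bounded_bilinear.has_vector_derivative[OF bounded_bilinear_inner])
    then have "((\<lambda>s. ?d s \<bullet> ?d s) has_field_derivative 2 * (?d s \<bullet> (F (x s) - F (y s))))
        (at s within {0..})"
      by (simp add: has_real_derivative_iff_has_vector_derivative inner_commute)
    moreover have "((\<lambda>s. exp (- 2 * L * s)) has_field_derivative - 2 * L * exp (- 2 * L * s))
        (at s within {0..})"
      by (auto intro!: derivative_eq_intros)
    ultimately have "(g has_field_derivative - 2 * L * exp (- 2 * L * s) * (?d s \<bullet> ?d s)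
        + 2 * (?d s \<bullet> (F (x s) - F (y s))) * exp (- 2 * L * s)) (at s within {0..})"
      unfolding g_def[abs_def] by (intro DERIV_mult)
    moreover have "- 2 * L * exp (- 2 * L * s) * (?d s \<bullet> ?d s)
        + 2 * (?d s \<bullet> (F (x s) - F (y s))) * exp (- 2 * L * s) = g' s"
      unfolding g'_def right_diff_distrib by (simp only: mult_minus_left mult_ac) simp
    ultimately show ?thesis by simp
  qed
  have g'_le: "g' s \<le> 0" for s
  proof -
    have "(x s - y s) \<bullet> (F (x s) - F (y s)) \<le> norm (x s - y s) * norm (F (x s) - F (y s))"
      by (rule norm_cauchy_schwarz)
    also have "\<dots> \<le> norm (x s - y s) * (L * norm (x s - y s))"
      using lipschitz_onD[OF F, of "x s" "y s"] by (intro mult_left_mono) (auto simp: dist_norm)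
    finally show ?thesis
      by (auto simp: g'_def mult_le_0_iff dot_square_norm power2_eq_square mult_ac)
  qed
  \<comment> \<open>At time \<open>0\<close> only a one-sided derivative is available, so the
    monotonicity rule is the one that asks for derivatives in the open interval and continuity on
    the closed one.\<close>
  have "g t \<le> g 0"
  proof (rule DERIV_nonpos_imp_decreasing_open[OF t])
    fix s assume s: "0 < s" "s < t"
    then have "at s within {0..} = at s" by (intro at_within_interior) simp
    then show "\<exists>d. (g has_field_derivative d) (at s) \<and> d \<le> 0"
      using deriv[of s] g'_le[of s] s by (intro exI[of _ "g' s"]) auto
  next
    show "continuous_on {0..t} g"
      by (rule DERIV_continuous_on[of _ _ g'])
         (auto intro: DERIV_subset[OF deriv])
  qed
  then have "(norm (x t - y t))\<^sup>2 \<le> exp (2 * L * t) * (norm (x 0 - y 0))\<^sup>2"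
    by (simp add: g_def dot_square_norm exp_minus field_simps)
  also have "\<dots> = (exp (L * t) * norm (x 0 - y 0))\<^sup>2"
    by (simp add: power_mult_distrib exp_double[symmetric] mult.assoc)
  finally show ?thesis by (rule power2_le_imp_le) simp
qed

section \<open>Existence on the half line by Picard iteration\<close>

primrec picard_iterate :: "('a::banach \<Rightarrow> 'a) \<Rightarrow> 'a \<Rightarrow> nat \<Rightarrow> real \<Rightarrow> 'a" where
  "picard_iterate F z 0 t = z"
| "picard_iterate F z (Suc n) t = z + integral {0..t} (\<lambda>s. F (picard_iterate F z n s))"

lemma continuous_on_picard_iterate:
  assumes "continuous_on UNIV F"
  shows "continuous_on {0..T} (picard_iterate F z n)"
proof (induction n)
  case (Suc n)
  have "continuous_on {0..T} (\<lambda>s. F (picard_iterate F z n s))"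
    by (rule continuous_on_compose2[OF assms Suc]) simp
  then show ?case
    by (auto intro!: continuous_intros indefinite_integral_continuous_1 integrable_continuous_real)
qed (simp add: continuous_on_const)

text \<open>The weight \<open>exp (2 * L * t)\<close> makes one Picard step a contraction with factor \<open>1/2\<close> on the
  whole half line, so no concatenation of local solutions is needed.\<close>

lemma picard_iterate_diff:
  assumes F: "L-lipschitz_on UNIV F" and L: "0 < L" and t: "0 \<le> t"
  shows "norm (picard_iterate F z (Suc n) t - picard_iterate F z n t)
           \<le> norm (F z) / (2 * L) * (1 / 2) ^ n * exp (2 * L * t)"
  using t
proof (induction n arbitrary: t)
  case 0
  \<comment> \<open>The zeroth iterate is constant, so the first difference is
    \<open>t *\<^sub>R F z\<close>; absorbing the factor \<open>t\<close> into the weight produces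
    the prefactor \<open>norm (F z) / (2 * L)\<close>.\<close>
  have "2 * L * t \<le> exp (2 * L * t)" using exp_ge_add_one_self[of "2 * L * t"] by linarith
  then have "t * norm (F z) \<le> norm (F z) / (2 * L) * exp (2 * L * t)"
    using L mult_left_mono[of "2 * L * t" "exp (2 * L * t)" "norm (F z)"]
    by (simp add: field_simps)
  then show ?case using 0 by simp
next
  case (Suc n)
  let ?X = "picard_iterate F z" and ?c = "norm (F z) / (2 * L) * (1 / 2) ^ n"
  have F_cont: "continuous_on UNIV F" using F by (rule lipschitz_on_continuous_on)
  have int: "(\<lambda>s. F (?X k s)) integrable_on {0..t}" for k
    by (intro integrable_continuous_real
        continuous_on_compose2[OF F_cont continuous_on_picard_iterate[OF F_cont]]) simp
  \<comment> \<open>Integrating the weight divides by \<open>2 * L\<close>, against the factor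
    \<open>L\<close> of the Lipschitz bound: this is the gain of \<open>1/2\<close> per step. The
    term at time \<open>0\<close> has a favourable sign and is dropped at the end.\<close>
  have exp_int: "((\<lambda>s. L * (?c * exp (2 * L * s))) has_integral
      ?c / 2 * exp (2 * L * t) - ?c / 2 * exp (2 * L * 0)) {0..t}"
    using L Suc.prems
    by (intro fundamental_theorem_of_calculus)
       (auto intro!: derivative_eq_intros simp: has_real_derivative_iff_has_vector_derivative[symmetric])
  have "?X (Suc (Suc n)) t - ?X (Suc n) t = integral {0..t} (\<lambda>s. F (?X (Suc n) s) - F (?X n s))"
    using int[of "Suc n"] int[of n] by (simp add: integral_diff)
  also have "norm \<dots> \<le> integral {0..t} (\<lambda>s. L * (?c * exp (2 * L * s)))"
  proof (rule integral_norm_bound_integral)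
    fix s assume s: "s \<in> {0..t}"
    have "norm (F (?X (Suc n) s) - F (?X n s)) \<le> L * norm (?X (Suc n) s - ?X n s)"
      using lipschitz_onD[OF F] by (simp add: dist_norm)
    also have "\<dots> \<le> L * (?c * exp (2 * L * s))"
      using Suc.IH[of s] s L by (intro mult_left_mono) auto
    finally show "norm (F (?X (Suc n) s) - F (?X n s)) \<le> L * (?c * exp (2 * L * s))" .
  qed (intro integrable_diff int has_integral_integrable[OF exp_int])+
  also have "\<dots> = ?c / 2 * exp (2 * L * t) - ?c / 2 * exp (2 * L * 0)"
    by (rule integral_unique[OF exp_int])
  also have "\<dots> \<le> ?c / 2 * exp (2 * L * t)" using L by simp
  finally show ?case by simp
qed

text \<open>The bounds of \<open>picard_iterate_diff\<close> are geometric and uniform on every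
  \<open>{0..T}\<close>, so the iterates converge uniformly there; the limit satisfies the integral
  equation, which is then differentiated.\<close>

lemma lipschitz_ivp_exists:
  fixes F :: "'a::banach \<Rightarrow> 'a"
  assumes F: "L-lipschitz_on UNIV F" and L: "0 < L"
  obtains x where "x 0 = z"
    "\<And>t. t \<ge> 0 \<Longrightarrow> (x has_vector_derivative F (x t)) (at t within {0..})"
proof -
  let ?X = "picard_iterate F z"
  \<comment> \<open>The limit is written as a telescoping series so that the Weierstrass M-test
    applies; the partial sums, with \<open>z\<close> added, are the iterates themselves.\<close>
  define x where "x t = z + (\<Sum>n. ?X (Suc n) t - ?X n t)" for t
  have F_cont: "continuous_on UNIV F" using F by (rule lipschitz_on_continuous_on)
  have lim: "uniform_limit {0..T} ?X x sequentially" for T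
  proof -
    let ?c = "norm (F z) / (2 * L) * exp (2 * L * T)"
    have "uniform_limit {0..T} (\<lambda>k t. \<Sum>n<k. ?X (Suc n) t - ?X n t)
        (\<lambda>t. \<Sum>n. ?X (Suc n) t - ?X n t) sequentially"
    proof (rule Weierstrass_m_test)
      show "norm (?X (Suc n) t - ?X n t) \<le> ?c * (1 / 2) ^ n" if "t \<in> {0..T}" for n t
      proof -
        have "norm (?X (Suc n) t - ?X n t)
            \<le> norm (F z) / (2 * L) * (1 / 2) ^ n * exp (2 * L * t)"
          using that by (intro picard_iterate_diff[OF F L]) simp
        also have "\<dots> \<le> norm (F z) / (2 * L) * (1 / 2) ^ n * exp (2 * L * T)"
          using that L by (intro mult_left_mono) auto
        finally show ?thesis by (simp add: mult_ac)
      qed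
    qed (intro summable_mult summable_geometric, simp)
    moreover have "uniform_limit {0..T} (\<lambda>_ _. z) (\<lambda>_. z) sequentially"
      by (rule uniform_limit_const)
    ultimately have "uniform_limit {0..T} (\<lambda>k t. z + (\<Sum>n<k. ?X (Suc n) t - ?X n t)) x sequentially"
      unfolding x_def by (rule uniform_limit_add[rotated])
    moreover have "z + (\<Sum>n<k. ?X (Suc n) t - ?X n t) = ?X k t" for k t
      using sum_lessThan_telescope[of "\<lambda>n. ?X n t" k] by simp
    ultimately show ?thesis by (simp only:)
  qed
  have x_cont: "continuous_on {0..T} x" for T
    by (rule uniform_limit_theorem[OF always_eventually lim])
       (intro allI continuous_on_picard_iterate[OF F_cont], simp)
  have Fx_cont: "continuous_on {0..T} (\<lambda>s. F (x s))" for T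
    by (rule continuous_on_compose2[OF F_cont x_cont]) simp
  \<comment> \<open>Uniform continuity of \<open>F\<close> carries the uniform convergence through
    \<open>F\<close>, so the limit can be taken under the integral in the Picard recursion.\<close>
  have x_eq: "x t = z + integral {0..t} (\<lambda>s. F (x s))" if t: "0 \<le> t" for t
  proof -
    have "uniform_limit {0..t} (\<lambda>n s. F (?X n s)) (\<lambda>s. F (x s)) sequentially"
      by (rule uniform_limit_compose_uniformly_continuous_on[OF lim
            lipschitz_on_uniformly_continuous[OF F]]) auto
    moreover have "continuous_on {0..t} (\<lambda>s. F (?X n s))" for n
      by (rule continuous_on_compose2[OF F_cont continuous_on_picard_iterate[OF F_cont]]) simp
    ultimately obtain I J where I: "\<And>n. ((\<lambda>s. F (?X n s)) has_integral I n) {0..t}"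
        and J: "((\<lambda>s. F (x s)) has_integral J) {0..t}" and "I \<longlonglongrightarrow> J"
      by (rule uniform_limit_integral) auto
    then have "(\<lambda>n. z + I n) \<longlonglongrightarrow> z + J" by (intro tendsto_intros)
    then have "(\<lambda>n. ?X (Suc n) t) \<longlonglongrightarrow> z + integral {0..t} (\<lambda>s. F (x s))"
      by (simp add: integral_unique[OF I] integral_unique[OF J])
    moreover have "(\<lambda>n. ?X (Suc n) t) \<longlonglongrightarrow> x t"
      using LIMSEQ_Suc[OF tendsto_uniform_limitI[OF lim[of t], of t]] t by simp
    ultimately show ?thesis by (rule LIMSEQ_unique[rotated])
  qed
  show thesis
  proof (rule that)
    show "x 0 = z" using x_eq[of 0] by simp
    fix t :: real assume t: "0 \<le> t"
    \<comment> \<open>The interval reaches past \<open>t\<close>, so that near \<open>t\<close> it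
      agrees with the half line \<open>{0..}\<close>.\<close>
    have "((\<lambda>u. z + integral {0..u} (\<lambda>s. F (x s))) has_vector_derivative 0 + F (x t))
        (at t within {0..t + 1})"
      by (intro has_vector_derivative_add has_vector_derivative_const
          integral_has_vector_derivative Fx_cont) (use t in auto)
    then have "(x has_vector_derivative 0 + F (x t)) (at t within {0..t + 1})"
      by (rule has_vector_derivative_transform[rotated 2]) (use t x_eq in auto)
    moreover have "at t within {0..t + 1} = at t within {0..}"
      by (rule at_within_nhd[of _ "{..<t + 1}"]) auto
    ultimately show "(x has_vector_derivative F (x t)) (at t within {0..})" by simp
  qed
qed

section \<open>The exact flow and the network prediction\<close>

text \<open>This justifies the definite description: by \<open>lipschitz_flow_distance\<close>, all
  solutions from the same initial value agree at nonnegative times.\<close>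

lemma exact_solution_eq:
  assumes "L-lipschitz_on UNIV (\<lambda>x. f x \<alpha>)" "solves_ivp f \<alpha> z x" "0 \<le> t"
  shows "exact_solution f \<alpha> z t = x t"
  unfolding exact_solution_def
proof (rule the_equality)
  fix u assume "\<exists>y. solves_ivp f \<alpha> z y \<and> y t = u"
  then obtain y where y: "solves_ivp f \<alpha> z y" "y t = u" by blast
  have "norm (y t - x t) \<le> exp (L * t) * norm (y 0 - x 0)"
    using assms y(1) by (intro lipschitz_flow_distance[of L "\<lambda>x. f x \<alpha>"]) (auto simp: solves_ivp_def)
  then show "u = x t" using assms(2) y by (simp add: solves_ivp_def)
qed (use assms in blast)

section \<open>The exact flow at a fixed parameter\<close>

context
  fixes f :: "real^'d \<Rightarrow> real^'l \<Rightarrow> real^'d" and \<alpha> :: "real^'l" and L :: real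
  assumes f: "L-lipschitz_on UNIV (\<lambda>x. f x \<alpha>)" and L: "0 < L"
begin

text \<open>The described values agree with a Picard solution on \<open>{0..}\<close>, and
  derivatives within \<open>{0..}\<close> see no other times, so the derivative carries
  over.\<close>

lemma exact_solution_solves: "solves_ivp f \<alpha> z (exact_solution f \<alpha> z)"
proof -
  obtain x where x: "solves_ivp f \<alpha> z x"
    using lipschitz_ivp_exists[OF f L, of z] unfolding solves_ivp_def by blast
  have eq: "exact_solution f \<alpha> z t = x t" if "0 \<le> t" for t
    using exact_solution_eq[OF f x that] .
  have "(exact_solution f \<alpha> z has_vector_derivative f (x t) \<alpha>) (at t within {0..})"
    if "0 \<le> t" for t
    by (rule has_vector_derivative_transform[where f=x]) (use x eq that in \<open>auto simp: solves_ivp_def\<close>)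
  then show ?thesis using x eq by (simp add: solves_ivp_def)
qed

lemma exact_solution_0: "exact_solution f \<alpha> z 0 = z"
  using exact_solution_solves by (simp add: solves_ivp_def)

lemma exact_solution_lipschitz:
  assumes "0 \<le> t"
  shows "norm (exact_solution f \<alpha> z t - exact_solution f \<alpha> w t) \<le> exp (L * t) * norm (z - w)"
  using lipschitz_flow_distance[OF f, of "exact_solution f \<alpha> z" "exact_solution f \<alpha> w" t]
    exact_solution_solves[of z] exact_solution_solves[of w] assms
  by (simp add: solves_ivp_def)

text \<open>The system is autonomous, so a solution shifted in time solves the same equation from
  the state reached at time \<open>s\<close>; uniqueness identifies the two.\<close>

lemma exact_solution_add:
  assumes s: "0 \<le> s" and t: "0 \<le> t"
  shows "exact_solution f \<alpha> z (s + t) = exact_solution f \<alpha> (exact_solution f \<alpha> z s) t"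
proof -
  let ?x = "exact_solution f \<alpha> z"
  have "((?x \<circ> (\<lambda>r. s + r)) has_vector_derivative 1 *\<^sub>R f (?x (s + r)) \<alpha>) (at r within {0..})"
    if "0 \<le> r" for r
  proof (rule vector_diff_chain_within)
    show "((\<lambda>r. s + r) has_vector_derivative 1) (at r within {0..})"
      by (auto intro!: derivative_eq_intros)
    \<comment> \<open>The shift maps \<open>{0..}\<close> into itself because
      \<open>0 \<le> s\<close>, so the derivative restricts to the image.\<close>
    show "(?x has_vector_derivative f (?x (s + r)) \<alpha>) (at (s + r) within (\<lambda>r. s + r) ` {0..})"
    proof (rule has_vector_derivative_within_subset)
      show "(?x has_vector_derivative f (?x (s + r)) \<alpha>) (at (s + r) within {0..})"
        using exact_solution_solves[of z] s that by (simp add: solves_ivp_def)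
    qed (use s in auto)
  qed
  then have "solves_ivp f \<alpha> (?x s) (?x \<circ> (\<lambda>r. s + r))"
    unfolding solves_ivp_def by (intro conjI allI impI) (simp_all only: o_apply scaleR_one add_0_right)
  from exact_solution_eq[OF f this t] show ?thesis by simp
qed

text \<open>The fundamental theorem of calculus. It makes the accuracy of the network a statement
  about one step of the exact flow.\<close>

lemma exact_solution_increment:
  assumes t: "0 \<le> t"
  shows "exact_solution f \<alpha> z t = z + effective_increment f z \<alpha> t"
proof -
  let ?x = "exact_solution f \<alpha> z"
  have "((\<lambda>s. f (?x s) \<alpha>) has_integral ?x t - ?x 0) {0..t}"
    using exact_solution_solves[of z] t
    by (intro fundamental_theorem_of_calculus)
       (auto simp: solves_ivp_def intro: has_vector_derivative_within_subset)
  then show ?thesis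
    by (simp add: effective_increment_def flow_map_def exact_solution_0 integral_unique)
qed

text \<open>Accuracy is asked for along the predicted trajectory, since that is where the network is
  evaluated.\<close>

lemma network_prediction_error:
  fixes N :: "real^('d + 'l + unit) \<Rightarrow> real^'d"
  assumes \<delta>: "\<And>i. i < k \<Longrightarrow> 0 \<le> \<delta> i \<and> \<delta> i \<le> \<Delta>"
    and acc: "\<And>i. i < k \<Longrightarrow> norm (N (network_input (network_prediction N \<delta> x0 i \<alpha>) \<alpha> (\<delta> i))
      - effective_increment f (network_prediction N \<delta> x0 i \<alpha>) \<alpha> (\<delta> i)) \<le> E"
  shows "norm (exact_solution f \<alpha> x0 (\<Sum>i<k. \<delta> i) - network_prediction N \<delta> x0 k \<alpha>)
    \<le> (\<Sum>j<k. exp (L * \<Delta>) ^ j) * E"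
  using assms
proof (induction k)
  case 0
  then show ?case by (simp add: exact_solution_0)
next
  case (Suc k)
  let ?\<phi> = "exact_solution f \<alpha>" and ?y = "network_prediction N \<delta> x0 k \<alpha>"
    and ?q = "exp (L * \<Delta>)" and ?t = "\<Sum>i<k. \<delta> i"
  have \<delta>k: "0 \<le> \<delta> k" "\<delta> k \<le> \<Delta>" using Suc.prems(1)[of k] by auto
  have t: "0 \<le> ?t" using Suc.prems(1) by (intro sum_nonneg) auto
  \<comment> \<open>The flow started from the predicted state \<open>?y\<close> is inserted: the
    first bracket is the old error carried along by the flow, the second the new error of this
    step.\<close>
  have "?\<phi> x0 (\<Sum>i<Suc k. \<delta> i) - network_prediction N \<delta> x0 (Suc k) \<alpha>
      = (?\<phi> (?\<phi> x0 ?t) (\<delta> k) - ?\<phi> ?y (\<delta> k))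
        - (N (network_input ?y \<alpha> (\<delta> k)) - effective_increment f ?y \<alpha> (\<delta> k))"
    using exact_solution_increment[OF \<delta>k(1), of ?y] exact_solution_add[OF t \<delta>k(1), of x0] by simp
  also have "norm \<dots> \<le> norm (?\<phi> (?\<phi> x0 ?t) (\<delta> k) - ?\<phi> ?y (\<delta> k))
      + norm (N (network_input ?y \<alpha> (\<delta> k)) - effective_increment f ?y \<alpha> (\<delta> k))"
    by (rule norm_triangle_ineq4)
  also have "\<dots> \<le> ?q * ((\<Sum>j<k. ?q ^ j) * E) + E"
  proof (rule add_mono)
    have "norm (?\<phi> (?\<phi> x0 ?t) (\<delta> k) - ?\<phi> ?y (\<delta> k)) \<le> exp (L * \<delta> k) * norm (?\<phi> x0 ?t - ?y)"
      by (rule exact_solution_lipschitz[OF \<delta>k(1)])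
    also have "\<dots> \<le> ?q * ((\<Sum>j<k. ?q ^ j) * E)"
      using Suc L \<delta>k by (intro mult_mono) auto
    finally show "norm (?\<phi> (?\<phi> x0 ?t) (\<delta> k) - ?\<phi> ?y (\<delta> k)) \<le> ?q * ((\<Sum>j<k. ?q ^ j) * E)" .
  qed (use Suc.prems(2)[of k] in simp)
  \<comment> \<open>Horner's form of the geometric sum: the term \<open>?q ^ 0\<close> supplies the
    lone \<open>E\<close>.\<close>
  also have "\<dots> = (\<Sum>j<Suc k. ?q ^ j) * E"
    by (simp add: sum.lessThan_Suc_shift sum_distrib_left sum_distrib_right distrib_right
        mult.assoc del: sum.lessThan_Suc)
  finally show ?case .
qed

end

section \<open>Comparison of statistics\<close>

lemma prob_density_on_measurable: "prob_density_on I \<rho> \<Longrightarrow> I \<in> sets lebesgue"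
  and prob_density_on_integrable: "prob_density_on I \<rho> \<Longrightarrow> integrable (lebesgue_on I) \<rho>"
  and prob_density_on_integral: "prob_density_on I \<rho> \<Longrightarrow> integral\<^sup>L (lebesgue_on I) \<rho> = 1"
  and prob_density_on_AE_nonneg: "prob_density_on I \<rho> \<Longrightarrow> AE y in lebesgue_on I. 0 \<le> \<rho> y"
  by (auto simp: prob_density_on_def has_bochner_integral_iff intro!: AE_I2)

lemma integrable_density_scaleR:
  fixes g :: "real^'l \<Rightarrow> real^'d"
  assumes \<rho>: "prob_density_on I \<rho>" and g: "g \<in> borel_measurable (lebesgue_on I)"
    and bound: "AE y in lebesgue_on I. norm (g y) \<le> K"
  shows "integrable (lebesgue_on I) (\<lambda>y. \<rho> y *\<^sub>R g y)"
proof (rule Bochner_Integration.integrable_bound)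
  show "integrable (lebesgue_on I) (\<lambda>y. \<rho> y * K)"
    using prob_density_on_integrable[OF \<rho>] by simp
  show "(\<lambda>y. \<rho> y *\<^sub>R g y) \<in> borel_measurable (lebesgue_on I)"
    using prob_density_on_integrable[OF \<rho>] g by measurable
  show "AE y in lebesgue_on I. norm (\<rho> y *\<^sub>R g y) \<le> norm (\<rho> y * K)"
    using bound by eventually_elim (auto simp: abs_mult intro!: mult_left_mono)
qed

lemma param_mean_diff:
  fixes g h :: "real^'l \<Rightarrow> real^'d"
  assumes "prob_density_on I \<rho>"
    and "g \<in> borel_measurable (lebesgue_on I)" "AE y in lebesgue_on I. norm (g y) \<le> K"
    and "h \<in> borel_measurable (lebesgue_on I)" "AE y in lebesgue_on I. norm (h y) \<le> K'"
  shows "param_mean I \<rho> g - param_mean I \<rho> h = param_mean I \<rho> (\<lambda>y. g y - h y)"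
  using integrable_density_scaleR[OF assms(1,2,3)] integrable_density_scaleR[OF assms(1,4,5)]
  by (simp add: param_mean_def scaleR_diff_right)

lemma norm_param_mean_le:
  fixes g :: "real^'l \<Rightarrow> real^'d"
  assumes \<rho>: "prob_density_on I \<rho>" and g: "g \<in> borel_measurable (lebesgue_on I)"
    and bound: "AE y in lebesgue_on I. norm (g y) \<le> K"
  shows "norm (param_mean I \<rho> g) \<le> K"
proof -
  have "norm (param_mean I \<rho> g) \<le> (\<integral>y. norm (\<rho> y *\<^sub>R g y) \<partial>lebesgue_on I)"
    unfolding param_mean_def by (rule integral_norm_bound)
  also have "\<dots> \<le> (\<integral>y. \<rho> y * K \<partial>lebesgue_on I)"
  proof (rule integral_mono_AE)
    show "AE y in lebesgue_on I. norm (\<rho> y *\<^sub>R g y) \<le> \<rho> y * K"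
      using bound prob_density_on_AE_nonneg[OF \<rho>]
      by eventually_elim (simp add: mult_left_mono)
  qed (use integrable_norm[OF integrable_density_scaleR[OF assms]] prob_density_on_integrable[OF \<rho>]
      in simp_all)
  also have "\<dots> = K" using prob_density_on_integral[OF \<rho>] by simp
  finally show ?thesis .
qed

text \<open>After extension by zero the difference of the means is a single integral against the
  difference of the densities. It is at most \<open>K\<close> times their L1 distance, which is the
  overlap integral plus the two excess masses.\<close>

lemma norm_param_mean_diff_density_le:
  fixes g :: "real^'l \<Rightarrow> real^'d"
  assumes \<rho>: "prob_density_on I \<rho>" and \<rho>': "prob_density_on J \<rho>'"
    and g: "g \<in> borel_measurable (lebesgue_on (I \<union> J))"
    and bound: "AE y in lebesgue_on (I \<union> J). norm (g y) \<le> K" and K: "0 \<le> K"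
    and overlap: "(\<integral>y. \<bar>\<rho> y - \<rho>' y\<bar> \<partial>lebesgue_on (I \<inter> J)) \<le> \<gamma>"
    and excess: "(\<integral>y. \<rho>' y \<partial>lebesgue_on (J - (I \<inter> J)))
      + (\<integral>y. \<rho> y \<partial>lebesgue_on (I - (I \<inter> J))) \<le> \<eta>"
  shows "norm (param_mean I \<rho> g - param_mean J \<rho>' g) \<le> K * (\<eta> + \<gamma>)"
proof -
  note [simp] = prob_density_on_measurable[OF \<rho>] prob_density_on_measurable[OF \<rho>']
  have IJ: "I \<union> J \<in> sets lebesgue" by (intro sets.Un) simp_all
  define r where "r y = indicator I y * \<rho> y" for y
  define r' where "r' y = indicator J y * \<rho>' y" for y
  \<comment> \<open>Off \<open>I \<union> J\<close> the function is set to zero; as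
    \<open>0 \<le> K\<close>, its bound then holds almost everywhere in the whole space.\<close>
  define G where "G y = indicator (I \<union> J) y *\<^sub>R g y" for y
  have r: "integrable lebesgue r" and r': "integrable lebesgue r'"
    using prob_density_on_integrable[OF \<rho>] prob_density_on_integrable[OF \<rho>']
    by (simp_all add: integrable_restrict_space r_def[abs_def] r'_def[abs_def])
  have G: "G \<in> borel_measurable lebesgue"
    using g borel_measurable_restrict_space_iff[of "I \<union> J" lebesgue g] IJ by (simp add: G_def[abs_def])
  have G_le: "AE y in lebesgue. norm (G y) \<le> K"
  proof -
    have "AE y in lebesgue. y \<in> I \<union> J \<longrightarrow> norm (g y) \<le> K"
      using bound IJ by (simp add: AE_restrict_space_iff)
    then show ?thesis by eventually_elim (use K in \<open>auto simp: G_def indicator_def\<close>)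
  qed
  have int_scaleR: "integrable lebesgue (\<lambda>y. w y *\<^sub>R G y)" if w: "integrable lebesgue w" for w
  proof (rule Bochner_Integration.integrable_bound)
    show "integrable lebesgue (\<lambda>y. w y * K)" using w by simp
    show "(\<lambda>y. w y *\<^sub>R G y) \<in> borel_measurable lebesgue" using w G by measurable
    show "AE y in lebesgue. norm (w y *\<^sub>R G y) \<le> norm (w y * K)"
      using G_le by eventually_elim (auto simp: abs_mult intro!: mult_left_mono)
  qed
  have "param_mean I \<rho> g = (\<integral>y. r y *\<^sub>R G y \<partial>lebesgue)"
    unfolding param_mean_def r_def G_def
    by (subst integral_restrict_space)
       (auto intro!: Bochner_Integration.integral_cong simp: indicator_def)
  moreover have "param_mean J \<rho>' g = (\<integral>y. r' y *\<^sub>R G y \<partial>lebesgue)"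
    unfolding param_mean_def r'_def G_def
    by (subst integral_restrict_space)
       (auto intro!: Bochner_Integration.integral_cong simp: indicator_def)
  ultimately have "param_mean I \<rho> g - param_mean J \<rho>' g = (\<integral>y. (r y - r' y) *\<^sub>R G y \<partial>lebesgue)"
    using int_scaleR[OF r] int_scaleR[OF r'] by (simp add: scaleR_diff_left)
  then have "norm (param_mean I \<rho> g - param_mean J \<rho>' g)
      \<le> (\<integral>y. norm ((r y - r' y) *\<^sub>R G y) \<partial>lebesgue)"
    by (simp add: integral_norm_bound del: norm_scaleR)
  also have "\<dots> \<le> (\<integral>y. \<bar>r y - r' y\<bar> * K \<partial>lebesgue)"
  proof (rule integral_mono_AE)
    show "integrable lebesgue (\<lambda>y. norm ((r y - r' y) *\<^sub>R G y))"
      using r r' by (intro integrable_norm int_scaleR Bochner_Integration.integrable_diff)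
    show "AE y in lebesgue. norm ((r y - r' y) *\<^sub>R G y) \<le> \<bar>r y - r' y\<bar> * K"
      using G_le by eventually_elim (simp add: mult_left_mono)
  qed (use r r' in auto)
  also have "\<dots> = K * (\<integral>y. \<bar>r y - r' y\<bar> \<partial>lebesgue)" by (simp add: mult.commute)
  also have "(\<integral>y. \<bar>r y - r' y\<bar> \<partial>lebesgue) = (\<integral>y. \<bar>\<rho> y - \<rho>' y\<bar> \<partial>lebesgue_on (I \<inter> J))
      + ((\<integral>y. \<rho>' y \<partial>lebesgue_on (J - (I \<inter> J))) + (\<integral>y. \<rho> y \<partial>lebesgue_on (I - (I \<inter> J))))"
  proof -
    define w where "w y = r y - r' y" for y
    have w: "integrable lebesgue w" using r r' by (simp add: w_def[abs_def])
    have abs_w: "integrable lebesgue (\<lambda>y. indicator A y *\<^sub>R \<bar>w y\<bar>)" if "A \<in> sets lebesgue" for A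
      using w that by (intro integrable_mult_indicator) auto
    have parts: "I \<inter> J \<in> sets lebesgue" "J - (I \<inter> J) \<in> sets lebesgue"
      "I - (I \<inter> J) \<in> sets lebesgue"
      by (intro sets.Int sets.Diff prob_density_on_measurable[OF \<rho>] prob_density_on_measurable[OF \<rho>'])+
    have nonneg: "y \<in> I \<Longrightarrow> 0 \<le> \<rho> y" "y \<in> J \<Longrightarrow> 0 \<le> \<rho>' y" for y
      using \<rho> \<rho>' by (auto simp: prob_density_on_def)
    \<comment> \<open>The three sets are disjoint and \<open>w\<close> vanishes outside them. On
      each excess set one extended density is zero, so \<open>\<bar>w y\<bar>\<close> is the other
      one by nonnegativity.\<close>
    have "(\<integral>y. \<bar>w y\<bar> \<partial>lebesgue) = (\<integral>y. indicator (I \<inter> J) y *\<^sub>R \<bar>w y\<bar>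
        + (indicator (J - (I \<inter> J)) y *\<^sub>R \<bar>w y\<bar> + indicator (I - (I \<inter> J)) y *\<^sub>R \<bar>w y\<bar>) \<partial>lebesgue)"
      by (intro Bochner_Integration.integral_cong) (auto simp: indicator_def w_def r_def r'_def)
    also have "\<dots> = (\<integral>y. indicator (I \<inter> J) y *\<^sub>R \<bar>w y\<bar> \<partial>lebesgue)
        + ((\<integral>y. indicator (J - (I \<inter> J)) y *\<^sub>R \<bar>w y\<bar> \<partial>lebesgue)
          + (\<integral>y. indicator (I - (I \<inter> J)) y *\<^sub>R \<bar>w y\<bar> \<partial>lebesgue))"
      using abs_w[of "I \<inter> J"] abs_w[of "J - (I \<inter> J)"] abs_w[of "I - (I \<inter> J)"]
      by (simp only: parts Bochner_Integration.integral_add Bochner_Integration.integrable_add)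
    also have "(\<integral>y. indicator (I \<inter> J) y *\<^sub>R \<bar>w y\<bar> \<partial>lebesgue)
        = (\<integral>y. \<bar>\<rho> y - \<rho>' y\<bar> \<partial>lebesgue_on (I \<inter> J))"
      by (subst integral_restrict_space)
         (auto intro!: Bochner_Integration.integral_cong simp: indicator_def w_def r_def r'_def)
    also have "(\<integral>y. indicator (J - (I \<inter> J)) y *\<^sub>R \<bar>w y\<bar> \<partial>lebesgue)
        = (\<integral>y. \<rho>' y \<partial>lebesgue_on (J - (I \<inter> J)))"
      by (subst integral_restrict_space)
         (auto intro!: Bochner_Integration.integral_cong simp: indicator_def w_def r_def r'_def nonneg parts)
    also have "(\<integral>y. indicator (I - (I \<inter> J)) y *\<^sub>R \<bar>w y\<bar> \<partial>lebesgue)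
        = (\<integral>y. \<rho> y \<partial>lebesgue_on (I - (I \<inter> J)))"
      by (subst integral_restrict_space)
         (auto intro!: Bochner_Integration.integral_cong simp: indicator_def w_def r_def r'_def nonneg parts)
    finally show ?thesis by (simp add: w_def)
  qed
  finally show ?thesis
    using mult_left_mono[OF add_mono[OF overlap excess] K] by (simp add: add.commute)
qed

section \<open>Componentwise squares and the variance\<close>

lemma norm_square_componentwise_diff_le:
  "norm (square_componentwise a - square_componentwise b) \<le> norm (a - b) * norm (a + b)"
proof -
  \<comment> \<open>Each component of \<open>a + b\<close> is at most its norm, so factoring the
    difference of squares compares the vector componentwise with a scalar multiple of
    \<open>a - b\<close>; no dimension factor arises.\<close>
  have "norm (square_componentwise a - square_componentwise b) \<le> norm (norm (a + b) *\<^sub>R (a - b))"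
  proof (rule norm_le_componentwise_cart)
    fix i
    have "\<bar>(a $ i)\<^sup>2 - (b $ i)\<^sup>2\<bar> = \<bar>(a + b) $ i\<bar> * \<bar>(a - b) $ i\<bar>"
      by (simp add: power2_eq_square square_diff_square_factored abs_mult)
    also have "\<dots> \<le> norm (a + b) * \<bar>(a - b) $ i\<bar>"
      by (intro mult_right_mono component_le_norm_cart) auto
    finally show "norm ((square_componentwise a - square_componentwise b) $ i)
        \<le> norm ((norm (a + b) *\<^sub>R (a - b)) $ i)"
      by (simp add: square_componentwise_def abs_mult)
  qed
  then show ?thesis by (simp add: mult.commute)
qed

lemma norm_square_componentwise_le: "norm (square_componentwise a) \<le> (norm a)\<^sup>2"
  using norm_square_componentwise_diff_le[of a 0]
  by (simp add: square_componentwise_def power2_eq_square zero_vec_def[symmetric])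

lemma borel_measurable_square_componentwise [measurable (raw)]:
  assumes "g \<in> borel_measurable M"
  shows "(\<lambda>y. square_componentwise (g y)) \<in> borel_measurable M"
proof (rule measurable_compose[OF assms borel_measurable_continuous_onI])
  show "continuous_on UNIV square_componentwise"
    unfolding square_componentwise_def[abs_def] by (intro continuous_intros)
qed

text \<open>Boundedness makes every term of the expanded square integrable, and total mass one turns
  the constant term into the squared mean.\<close>

lemma param_variance_eq:
  fixes g :: "real^'l \<Rightarrow> real^'d"
  assumes \<rho>: "prob_density_on I \<rho>" and g: "g \<in> borel_measurable (lebesgue_on I)"
    and bound: "AE y in lebesgue_on I. norm (g y) \<le> K"
  shows "param_variance I \<rho> g
    = param_mean I \<rho> (\<lambda>y. square_componentwise (g y)) - square_componentwise (param_mean I \<rho> g)"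
proof (rule vec_eq_iff[THEN iffD2, rule_format])
  fix i
  define m where "m = param_mean I \<rho> g"
  have [measurable]: "g \<in> borel_measurable (lebesgue_on I)" by (rule g)
  \<comment> \<open>Coordinate projection is bounded and linear, so it commutes with the
    integral.\<close>
  have nth: "integral\<^sup>L (lebesgue_on I) h $ i = (\<integral>y. h y $ i \<partial>lebesgue_on I)"
    and int_nth: "integrable (lebesgue_on I) (\<lambda>y. h y $ i)"
    if "integrable (lebesgue_on I) h" for h :: "real^'l \<Rightarrow> real^'d"
    using integral_bounded_linear[OF bounded_linear_vec_nth that]
      integrable_bounded_linear[OF bounded_linear_vec_nth that] by auto
  have g_int: "integrable (lebesgue_on I) (\<lambda>y. \<rho> y *\<^sub>R g y)"
    by (rule integrable_density_scaleR[OF assms])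
  have sq_int: "integrable (lebesgue_on I) (\<lambda>y. \<rho> y *\<^sub>R square_componentwise (g y))"
  proof (rule integrable_density_scaleR[OF \<rho>])
    show "AE y in lebesgue_on I. norm (square_componentwise (g y)) \<le> K\<^sup>2"
      using bound by eventually_elim
        (meson norm_square_componentwise_le norm_ge_zero order_trans power_mono)
  qed measurable
  have dev_int: "integrable (lebesgue_on I) (\<lambda>y. \<rho> y *\<^sub>R square_componentwise (g y - m))"
  proof (rule integrable_density_scaleR[OF \<rho>])
    show "AE y in lebesgue_on I. norm (square_componentwise (g y - m)) \<le> (K + norm m)\<^sup>2"
      using bound
    proof eventually_elim
      case (elim y)
      then have "norm (g y - m) \<le> K + norm m" using norm_triangle_ineq4[of "g y" m] by linarith
      then show ?case
        by (meson norm_square_componentwise_le norm_ge_zero order_trans power_mono)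
    qed
  qed measurable
  have "param_variance I \<rho> g $ i = (\<integral>y. \<rho> y * (g y $ i)\<^sup>2
      - (2 * m $ i) * (\<rho> y * g y $ i) + (m $ i)\<^sup>2 * \<rho> y \<partial>lebesgue_on I)"
    unfolding param_variance_def m_def[symmetric] nth[OF dev_int]
    by (intro Bochner_Integration.integral_cong)
       (auto simp: square_componentwise_def power2_eq_square algebra_simps)
  also have "\<dots> = (\<integral>y. \<rho> y * (g y $ i)\<^sup>2 \<partial>lebesgue_on I)
      - (2 * m $ i) * (\<integral>y. \<rho> y * g y $ i \<partial>lebesgue_on I) + (m $ i)\<^sup>2"
    using int_nth[OF g_int] int_nth[OF sq_int] prob_density_on_integrable[OF \<rho>]
      prob_density_on_integral[OF \<rho>]
    by (simp add: square_componentwise_def)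
  also have "(\<integral>y. \<rho> y * g y $ i \<partial>lebesgue_on I) = m $ i"
    using nth[OF g_int] by (simp add: m_def param_mean_def)
  also have "(\<integral>y. \<rho> y * (g y $ i)\<^sup>2 \<partial>lebesgue_on I)
      = param_mean I \<rho> (\<lambda>y. square_componentwise (g y)) $ i"
    using nth[OF sq_int] by (simp add: param_mean_def square_componentwise_def)
  finally show "param_variance I \<rho> g $ i = (param_mean I \<rho> (\<lambda>y. square_componentwise (g y))
      - square_componentwise (param_mean I \<rho> g)) $ i"
    by (simp add: m_def square_componentwise_def power2_eq_square)
qed

text \<open>Both bounds pass through the statistics of \<open>X\<close> under
  \<open>\<rho>'\<close>. In the variance bound, \<open>3 * K\<^sup>2\<close> is
  \<open>K\<^sup>2\<close> from the second moment plus \<open>2 * K\<^sup>2\<close> from the squared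
  mean, and each of these two adds \<open>M * (2 * K + M)\<close> for replacing \<open>X\<close> by
  \<open>Y\<close>.\<close>

lemma statistics_perturbation:
  fixes X Y :: "real^'l \<Rightarrow> real^'d"
  assumes \<rho>: "prob_density_on I \<rho>" and \<rho>': "prob_density_on J \<rho>'"
    and X: "X \<in> borel_measurable (lebesgue_on (I \<union> J))"
    and Y: "Y \<in> borel_measurable (lebesgue_on J)"
    and X_le: "AE y in lebesgue_on (I \<union> J). norm (X y) \<le> K"
    and XY: "AE y in lebesgue_on J. norm (X y - Y y) \<le> M" and M: "0 \<le> M"
    and overlap: "(\<integral>y. \<bar>\<rho> y - \<rho>' y\<bar> \<partial>lebesgue_on (I \<inter> J)) \<le> \<gamma>"
    and excess: "(\<integral>y. \<rho>' y \<partial>lebesgue_on (J - (I \<inter> J)))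
      + (\<integral>y. \<rho> y \<partial>lebesgue_on (I - (I \<inter> J))) \<le> \<eta>"
  shows "norm (param_mean I \<rho> X - param_mean J \<rho>' Y) \<le> K * (\<eta> + \<gamma>) + M"
    and "norm (param_variance I \<rho> X - param_variance J \<rho>' Y)
      \<le> 3 * K\<^sup>2 * (\<eta> + \<gamma>) + 2 * M * (2 * K + M)"
proof -
  note [simp] = prob_density_on_measurable[OF \<rho>] prob_density_on_measurable[OF \<rho>']
  have XI: "X \<in> borel_measurable (lebesgue_on I)" and XJ: "X \<in> borel_measurable (lebesgue_on J)"
    using X by (auto intro: measurable_restrict_mono)
  have XI_le: "AE y in lebesgue_on I. norm (X y) \<le> K" and XJ_le: "AE y in lebesgue_on J. norm (X y) \<le> K"
    using X_le sets.Un[of I lebesgue J] by (auto simp: AE_restrict_space_iff elim: eventually_mono)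
  have Y_le: "AE y in lebesgue_on J. norm (Y y) \<le> K + M"
    using XJ_le XY
  proof eventually_elim
    case (elim y)
    then show ?case using norm_triangle_ineq3[of "X y" "Y y"] by linarith
  qed
  let ?sq = "\<lambda>g y. square_componentwise (g y)"
  \<comment> \<open>From \<open>a\<close> to \<open>b\<close> the density changes, from
    \<open>b\<close> to \<open>c\<close> the function.\<close>
  define a where "a = param_mean I \<rho> X"
  define b where "b = param_mean J \<rho>' X"
  define c where "c = param_mean J \<rho>' Y"
  have a: "norm a \<le> K" unfolding a_def by (rule norm_param_mean_le[OF \<rho> XI XI_le])
  have b: "norm b \<le> K" unfolding b_def by (rule norm_param_mean_le[OF \<rho>' XJ XJ_le])
  have c: "norm c \<le> K + M" unfolding c_def by (rule norm_param_mean_le[OF \<rho>' Y Y_le])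
  have K: "0 \<le> K" using a norm_ge_zero order_trans by blast
  have ab: "norm (a - b) \<le> K * (\<eta> + \<gamma>)" unfolding a_def b_def
    by (rule norm_param_mean_diff_density_le[OF \<rho> \<rho>' X X_le K overlap excess])
  have bc: "norm (b - c) \<le> M"
    unfolding b_def c_def param_mean_diff[OF \<rho>' XJ XJ_le Y Y_le]
    by (rule norm_param_mean_le[OF \<rho>' borel_measurable_diff[OF XJ Y] XY])
  show "norm (param_mean I \<rho> X - param_mean J \<rho>' Y) \<le> K * (\<eta> + \<gamma>) + M"
    using norm_triangle_ineq[of "a - b" "b - c"] ab bc by (simp add: a_def c_def)

  have sq_le: "norm (square_componentwise v) \<le> R\<^sup>2" if "norm v \<le> R" for v :: "real^'d" and R
    using norm_square_componentwise_le[of v] power_mono[OF that, of 2] by simp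
  \<comment> \<open>The same change of density, now for \<open>?sq X\<close> with the bound
    \<open>K\<^sup>2\<close>.\<close>
  have sqX: "norm (param_mean I \<rho> (?sq X) - param_mean J \<rho>' (?sq X)) \<le> K\<^sup>2 * (\<eta> + \<gamma>)"
    using X_le
    by (intro norm_param_mean_diff_density_le[OF \<rho> \<rho>' _ _ _ overlap excess]
        borel_measurable_square_componentwise X) (auto elim: eventually_mono intro: sq_le)
  have sqXY: "norm (param_mean J \<rho>' (?sq X) - param_mean J \<rho>' (?sq Y)) \<le> M * (2 * K + M)"
  proof -
    have "param_mean J \<rho>' (?sq X) - param_mean J \<rho>' (?sq Y)
        = param_mean J \<rho>' (\<lambda>y. ?sq X y - ?sq Y y)"
      using XJ_le Y_le
      by (intro param_mean_diff[OF \<rho>', where K="K\<^sup>2" and K'="(K + M)\<^sup>2"]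
          borel_measurable_square_componentwise XJ Y) (auto elim: eventually_mono intro: sq_le)
    also have "norm \<dots> \<le> M * (2 * K + M)"
    proof (rule norm_param_mean_le[OF \<rho>'])
      show "AE y in lebesgue_on J. norm (?sq X y - ?sq Y y) \<le> M * (2 * K + M)"
        using XJ_le Y_le XY
      proof eventually_elim
        case (elim y)
        have "norm (?sq X y - ?sq Y y) \<le> norm (X y - Y y) * norm (X y + Y y)"
          by (rule norm_square_componentwise_diff_le)
        \<comment> \<open>The second factor is at most \<open>K + (K + M)\<close>.\<close>
        also have "\<dots> \<le> M * (2 * K + M)"
          using elim norm_triangle_ineq[of "X y" "Y y"] M by (intro mult_mono) auto
        finally show ?case .
      qed
    qed (intro borel_measurable_diff borel_measurable_square_componentwise XJ Y)
    finally show ?thesis .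
  qed
  have sqab: "norm (square_componentwise a - square_componentwise b) \<le> 2 * K\<^sup>2 * (\<eta> + \<gamma>)"
  proof -
    have "norm (square_componentwise a - square_componentwise b) \<le> norm (a - b) * norm (a + b)"
      by (rule norm_square_componentwise_diff_le)
    \<comment> \<open>The norm of \<open>a + b\<close> is at most \<open>2 * K\<close>, whence the
      \<open>2\<close>; the first bound is nonnegative because it dominates a norm.\<close>
    also have "\<dots> \<le> (K * (\<eta> + \<gamma>)) * (2 * K)"
      using ab a b norm_triangle_ineq[of a b] order_trans[OF norm_ge_zero ab]
      by (intro mult_mono) auto
    finally show ?thesis by (simp add: power2_eq_square mult_ac)
  qed
  have sqbc: "norm (square_componentwise b - square_componentwise c) \<le> M * (2 * K + M)"
  proof -
    have "norm (square_componentwise b - square_componentwise c) \<le> norm (b - c) * norm (b + c)"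
      by (rule norm_square_componentwise_diff_le)
    also have "\<dots> \<le> M * (2 * K + M)"
      using bc b c norm_triangle_ineq[of b c] M by (intro mult_mono) auto
    finally show ?thesis .
  qed
  have "param_variance I \<rho> X - param_variance J \<rho>' Y
      = ((param_mean I \<rho> (?sq X) - param_mean J \<rho>' (?sq X))
          + (param_mean J \<rho>' (?sq X) - param_mean J \<rho>' (?sq Y)))
        - ((square_componentwise a - square_componentwise b)
          + (square_componentwise b - square_componentwise c))"
    unfolding param_variance_eq[OF \<rho> XI XI_le] param_variance_eq[OF \<rho>' Y Y_le] a_def b_def c_def
    by simp
  also have "norm \<dots> \<le> (K\<^sup>2 * (\<eta> + \<gamma>) + M * (2 * K + M)) + (2 * K\<^sup>2 * (\<eta> + \<gamma>) + M * (2 * K + M))"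
    by (intro order_trans[OF norm_triangle_ineq4] add_mono order_trans[OF norm_triangle_ineq]
        sqX sqXY sqab sqbc)
  finally show "norm (param_variance I \<rho> X - param_variance J \<rho>' Y)
      \<le> 3 * K\<^sup>2 * (\<eta> + \<gamma>) + 2 * M * (2 * K + M)"
    by (simp add: algebra_simps)
qed

text \<open>The prediction is averaged over \<open>I\<alpha>t\<close>, so its error has to be
  controlled there: \<open>lipschitz_t\<close> reads well-posedness as the same Lipschitz condition
  on that range, \<open>accuracy\<close> covers \<open>I\<alpha>t\<close> as well, and
  \<open>states\<close> keeps the predicted states in \<open>Ix\<close>, where accuracy is
  assumed.\<close>

theorem theorem3p4:
  fixes f :: "real^'d \<Rightarrow> real^'l \<Rightarrow> real^'d"
    and N :: "real^('d + 'l + unit) \<Rightarrow> real^'d"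
    and Ix :: "(real^'d) set" and x0 :: "real^'d"
    and I\<alpha> I\<alpha>t :: "(real^'l) set"
    and \<rho> \<rho>t :: "real^'l \<Rightarrow> real"
    and I\<Delta> :: "real set" and \<Delta>0 \<Delta> t L E \<gamma> \<eta> Ct C :: real
    and \<delta> :: "nat \<Rightarrow> real" and n :: nat
  assumes density: "prob_density_on I\<alpha> \<rho>"
    and density_t: "prob_density_on I\<alpha>t \<rho>t"
    and I\<Delta>: "0 \<le> \<Delta>0" "\<Delta>0 \<le> \<Delta>" "0 < \<Delta>" "I\<Delta> = {\<Delta>0..\<Delta>}"
    and n: "1 \<le> n"
    and \<delta>: "\<And>k. k < n \<Longrightarrow> \<delta> k \<in> I\<Delta>"
    and t: "t = (\<Sum>i<n. \<delta> i)"
    and L: "0 < L"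
    and lipschitz: "\<And>\<alpha>. \<alpha> \<in> I\<alpha> \<Longrightarrow> L-lipschitz_on UNIV (\<lambda>x. f x \<alpha>)"
    and lipschitz_t: "\<And>\<alpha>. \<alpha> \<in> I\<alpha>t \<Longrightarrow> L-lipschitz_on UNIV (\<lambda>x. f x \<alpha>)"
    and network: "feedforward_network N"
    and E: "0 < E"
    and accuracy: "\<And>z \<alpha> \<tau>. z \<in> Ix \<Longrightarrow> \<alpha> \<in> I\<alpha> \<union> I\<alpha>t \<Longrightarrow> \<tau> \<in> I\<Delta> \<Longrightarrow>
      norm (N (network_input z \<alpha> \<tau>) - effective_increment f z \<alpha> \<tau>) \<le> E"
    and x0: "x0 \<in> Ix"
    and states: "\<And>\<alpha> k. \<alpha> \<in> I\<alpha>t \<Longrightarrow> k < n \<Longrightarrow> network_prediction N \<delta> x0 k \<alpha> \<in> Ix"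
    and measurable_exact:
      "(\<lambda>\<alpha>. exact_solution f \<alpha> x0 t) \<in> borel_measurable (lebesgue_on (I\<alpha> \<union> I\<alpha>t))"
    and measurable_prediction:
      "network_prediction N \<delta> x0 n \<in> borel_measurable (lebesgue_on I\<alpha>t)"
    and \<gamma>: "0 < \<gamma>" and \<eta>: "0 < \<eta>"
    and overlap: "(\<integral>y. \<bar>\<rho> y - \<rho>t y\<bar> \<partial>lebesgue_on (I\<alpha> \<inter> I\<alpha>t)) \<le> \<gamma>"
    and excess: "(\<integral>y. \<rho>t y \<partial>lebesgue_on (I\<alpha>t - (I\<alpha> \<inter> I\<alpha>t)))
      + (\<integral>y. \<rho> y \<partial>lebesgue_on (I\<alpha> - (I\<alpha> \<inter> I\<alpha>t))) \<le> \<eta>"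
    and bound: "Linf_norm (I\<alpha>t \<union> I\<alpha>) (\<lambda>\<alpha>. exact_solution f \<alpha> x0 t) \<le> ereal Ct"
    and C: "C = (exp (real n * L * \<Delta>) - 1) / (exp (L * \<Delta>) - 1)"
  shows "norm (param_mean I\<alpha> \<rho> (\<lambda>\<alpha>. exact_solution f \<alpha> x0 t)
            - param_mean I\<alpha>t \<rho>t (network_prediction N \<delta> x0 n))
          \<le> Ct * (\<eta> + \<gamma>) + C * (1 + \<eta>) * E
    \<and> norm (param_variance I\<alpha> \<rho> (\<lambda>\<alpha>. exact_solution f \<alpha> x0 t)
            - param_variance I\<alpha>t \<rho>t (network_prediction N \<delta> x0 n))
          \<le> (3 * Ct\<^sup>2 + C * Ct * E) * (\<eta> + \<gamma>) + (4 * Ct + 2 * C * E) * (1 + \<eta>) * C * E"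
proof -
  let ?X = "\<lambda>\<alpha>. exact_solution f \<alpha> x0 t" and ?Y = "network_prediction N \<delta> x0 n"
  define M where "M = C * E"
  \<comment> \<open>As \<open>L\<close> and \<open>\<Delta>\<close> are positive, the closed form is
    a geometric sum; the error estimate produces it in this form, which also shows
    \<open>0 \<le> C\<close>.\<close>
  have "C = (\<Sum>j<n. exp (L * \<Delta>) ^ j)"
  proof -
    have "exp (L * \<Delta>) \<noteq> 1" using L I\<Delta> by simp
    then show ?thesis
      unfolding C using geometric_sum[of "exp (L * \<Delta>)" n]
      by (simp only: exp_of_nat_mult mult.assoc not_False_eq_True)
  qed
  then have M_eq: "M = (\<Sum>j<n. exp (L * \<Delta>) ^ j) * E" and C_nonneg: "0 \<le> C"
    by (simp_all add: M_def sum_nonneg)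
  have M: "0 \<le> M" using C_nonneg E by (simp add: M_def)
  have meas: "I\<alpha> \<in> sets lebesgue" "I\<alpha>t \<in> sets lebesgue"
    using density density_t by (simp_all add: prob_density_on_def)
  have X_le: "AE \<alpha> in lebesgue_on (I\<alpha> \<union> I\<alpha>t). norm (?X \<alpha>) \<le> Ct"
  proof -
    \<comment> \<open>A function is almost everywhere at most its essential supremum, which is
      bounded here by the real number \<open>Ct\<close>.\<close>
    have "AE \<alpha> in lebesgue_on (I\<alpha>t \<union> I\<alpha>). ereal (norm (?X \<alpha>)) \<le> Linf_norm (I\<alpha>t \<union> I\<alpha>) ?X"
      unfolding Linf_norm_def by (rule esssup_AE)
    then have "AE \<alpha> in lebesgue_on (I\<alpha>t \<union> I\<alpha>). norm (?X \<alpha>) \<le> Ct"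
      by eventually_elim (use bound in \<open>metis ereal_less_eq(3) order_trans\<close>)
    then show ?thesis by (subst Un_commute)
  qed
  have XY: "norm (?X \<alpha> - ?Y \<alpha>) \<le> M" if "\<alpha> \<in> I\<alpha>t" for \<alpha>
    unfolding t M_eq
  proof (rule network_prediction_error[where f=f and \<alpha>=\<alpha> and L=L, OF lipschitz_t[OF that] L])
    show "0 \<le> \<delta> i \<and> \<delta> i \<le> \<Delta>" if "i < n" for i using \<delta>[OF that] I\<Delta> by auto
    show "norm (N (network_input (network_prediction N \<delta> x0 i \<alpha>) \<alpha> (\<delta> i))
        - effective_increment f (network_prediction N \<delta> x0 i \<alpha>) \<alpha> (\<delta> i)) \<le> E" if "i < n" for i
      using \<open>\<alpha> \<in> I\<alpha>t\<close> that by (intro accuracy states \<delta>) auto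
  qed
  have XY_AE: "AE \<alpha> in lebesgue_on I\<alpha>t. norm (?X \<alpha> - ?Y \<alpha>) \<le> M"
    using XY by (intro AE_I2) simp
  note perturbation = statistics_perturbation[OF density density_t measurable_exact
      measurable_prediction X_le XY_AE M overlap excess]
  \<comment> \<open>This serves to fix the sign of \<open>Ct\<close>, on which the enlargement of
    the variance bound below relies.\<close>
  have X_mean: "norm (param_mean I\<alpha> \<rho> ?X) \<le> Ct"
    using X_le measurable_exact meas sets.Un[OF meas]
    by (intro norm_param_mean_le[OF density])
       (auto simp: AE_restrict_space_iff elim: eventually_mono intro: measurable_restrict_mono)
  have Ct: "0 \<le> Ct" using X_mean norm_ge_zero order_trans by blast
  have "M \<le> C * (1 + \<eta>) * E"
    using mult_nonneg_nonneg[OF M less_imp_le[OF \<eta>]] by (simp add: M_def algebra_simps)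
  moreover have "3 * Ct\<^sup>2 * (\<eta> + \<gamma>) + 2 * M * (2 * Ct + M)
      \<le> (3 * Ct\<^sup>2 + C * Ct * E) * (\<eta> + \<gamma>) + (4 * Ct + 2 * C * E) * (1 + \<eta>) * C * E"
  proof -
    \<comment> \<open>The right side here is exactly the claimed bound minus the one from
      \<open>statistics_perturbation\<close>.\<close>
    have "0 \<le> M * Ct * (\<eta> + \<gamma>) + (4 * Ct + 2 * M) * \<eta> * M"
      using M Ct \<eta> \<gamma> by simp
    then show ?thesis by (simp add: M_def algebra_simps)
  qed
  ultimately show ?thesis using perturbation by linarith
qed

end
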